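(* Let $R,E\in\mathbb{C}^{M\times M}$ be Hermitian, $\widehat R=R+E$, and let $B_1,\dots,B_d\in\mathbb{C}^{M\times M}$ be linearly independent. For Hermitian $X$ let $\mathbf{M}(X)_{ij}=\operatorname{Tr}(B_i^H[X,[X,B_j]])$, let $\mathbf{G}_{ij}=\operatorname{Tr}(B_i^HB_j)$, let $\lambda_{\min}(X)$ be the smallest generalized eigenvalue of $\mathbf{M}(X)\mathbf{c}=\lambda\mathbf{G}\mathbf{c}$, and put $\Delta\mathbf{M}=\mathbf{M}(\widehat R)-\mathbf{M}(R)$, $\kappa_G=\|\mathbf{G}^{-1}\|_2$, $C_{\mathcal{B}}=\sum_i\|B_i\|_F^2$. Then $$\bigl|\lambda_{\min}(\widehat R)-\lambda_{\min}(R)\bigr|\le\kappa_G\,\|\Delta\mathbf{M}\|_2\le 4\kappa_G C_{\mathcal{B}}\,\|E\|_2\bigl(2\|R\|_2+\|E\|_2\bigr).$$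
   Context: $[X,Y]=XY-YX$; $\|\cdot\|_F$ is the Frobenius norm and $\|\cdot\|_2$ the operator norm. *)

theory Defs
  imports "HOL-Analysis.Analysis"
begin

text \<open>
  The Frobenius norm of \<open>A :: complex^'n^'m\<close> is the library's \<^const>\<open>norm\<close>: the Euclidean norm
  of the vector of Euclidean norms of the rows.
\<close>

definition conj_transpose :: "complex^'n^'m \<Rightarrow> complex^'m^'n" where
  "conj_transpose A = (\<chi> i j. cnj (A $ j $ i))"

definition hermitian :: "complex^'n^'n \<Rightarrow> bool" where
  "hermitian A \<longleftrightarrow> conj_transpose A = A"

definition commutator :: "complex^'n^'n \<Rightarrow> complex^'n^'n \<Rightarrow> complex^'n^'n" where
  "commutator X Y = X ** Y - Y ** X"

definition op_norm :: "complex^'n^'m \<Rightarrow> real" where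
  "op_norm A = onorm (\<lambda>x. A *v x)"

text \<open>
  Linear independence over the complex numbers of an indexed family of matrices. The library's
  \<^const>\<open>independent\<close> concerns real scalars, and sets instead of families. Scalar multiplication
  is written out entrywise, since \<open>(*s)\<close> on \<open>complex^'n^'m\<close> takes its scalars from \<open>complex^'n\<close>.
\<close>
definition lin_indep_family :: "('d::finite \<Rightarrow> complex^'n^'m) \<Rightarrow> bool" where
  "lin_indep_family B \<longleftrightarrow>
     (\<forall>c :: 'd \<Rightarrow> complex. (\<Sum>i\<in>UNIV. (\<chi> k l. c i * B i $ k $ l)) = 0 \<longrightarrow> (\<forall>i. c i = 0))"

definition M_mat :: "('d::finite \<Rightarrow> complex^'n^'n) \<Rightarrow> complex^'n^'n \<Rightarrow> complex^'d^'d" where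
  "M_mat B X = (\<chi> i j. trace (conj_transpose (B i) ** commutator X (commutator X (B j))))"

definition gram_mat :: "('d::finite \<Rightarrow> complex^'n^'n) \<Rightarrow> complex^'d^'d" where
  "gram_mat B = (\<chi> i j. trace (conj_transpose (B i) ** B j))"

definition gen_eigenvalues :: "complex^'d^'d \<Rightarrow> complex^'d^'d \<Rightarrow> complex set" where
  "gen_eigenvalues A G = {\<mu>. \<exists>c. c \<noteq> 0 \<and> A *v c = \<mu> *s (G *v c)}"

text \<open>
  For Hermitian \<open>X\<close> and linearly independent \<open>B\<close>, \<open>M_mat B X\<close> is Hermitian and \<open>gram_mat B\<close> is
  Hermitian positive definite, so the generalized eigenvalues form a nonempty finite set of real
  numbers. There \<^const>\<open>Re\<close> only changes the type, and the minimum below is the smallest generalized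
  eigenvalue.
\<close>
definition lambda_min :: "('d::finite \<Rightarrow> complex^'n^'n) \<Rightarrow> complex^'n^'n \<Rightarrow> real" where
  "lambda_min B X = Min (Re ` gen_eigenvalues (M_mat B X) (gram_mat B))"

definition kappa_G :: "('d::finite \<Rightarrow> complex^'n^'n) \<Rightarrow> real" where
  "kappa_G B = op_norm (matrix_inv (gram_mat B))"

definition C_B :: "('d::finite \<Rightarrow> complex^'n^'n) \<Rightarrow> real" where
  "C_B B = (\<Sum>i\<in>UNIV. (norm (B i))\<^sup>2)"

end

theory Submission
  imports Defs
begin

text \<open>
  The real inner product on \<open>complex^'n\<close> is the real part of the Hermitian one, so a Hermitian \<open>A\<close> is
  self-adjoint for it, and the quotient of \<open>inner x (A *v x)\<close> by \<open>inner x (G *v x)\<close> attains its minimum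
  on the unit sphere. A minimizer is a generalized eigenvector, so the minimum is the smallest
  generalized eigenvalue; eigenvectors of distinct eigenvalues are orthogonal with respect to \<open>G\<close>,
  so there are only finitely many eigenvalues. Testing the quotient of \<open>A'\<close> with a minimizer for
  \<open>A\<close> gives the first inequality. For Hermitian \<open>X\<close> the operator \<open>commutator X\<close> is self-adjoint for the
  Frobenius inner product, so \<open>M_mat B X\<close> is the Gram matrix of the family \<open>commutator X (B i)\<close>, in
  particular Hermitian. Writing \<open>ad\<close> for \<open>commutator\<close>, \<open>(ad (R + E))\<^sup>2 - (ad R)\<^sup>2\<close> is
  \<open>ad R ad E + ad E ad R + (ad E)\<^sup>2\<close>, and \<open>ad X\<close> has norm at most twice the operator norm of \<open>X\<close>.
\<close>

section \<open>Hermitian matrices and the real inner product\<close>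

lemma inner_complex_Re: "inner z w = Re (cnj z * w)" for z w :: complex
  by (simp add: inner_complex_def)

lemma inner_conj_transpose:
  fixes A :: "complex^'n^'m"
  shows "inner x (A *v y) = inner (conj_transpose A *v x) y"
proof -
  have "(\<Sum>i\<in>UNIV. cnj (x $ i) * (\<Sum>j\<in>UNIV. A $ i $ j * y $ j))
      = (\<Sum>i\<in>UNIV. \<Sum>j\<in>UNIV. cnj (x $ i) * A $ i $ j * y $ j)"
    by (simp add: sum_distrib_left mult.assoc)
  also have "\<dots> = (\<Sum>j\<in>UNIV. \<Sum>i\<in>UNIV. cnj (x $ i) * A $ i $ j * y $ j)"
    by (rule sum.swap)
  also have "\<dots> = (\<Sum>j\<in>UNIV. cnj (\<Sum>i\<in>UNIV. cnj (A $ i $ j) * x $ i) * y $ j)"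
    by (simp add: sum_distrib_left mult.commute cnj_sum)
  finally show ?thesis
    unfolding inner_vec_def inner_complex_Re Re_sum[symmetric]
    by (simp add: matrix_vector_mult_def conj_transpose_def)
qed

lemma hermitian_inner:
  assumes "hermitian A"
  shows "inner x (A *v y) = inner (A *v x) y"
  using assms inner_conj_transpose[of x A y] by (simp add: hermitian_def)

lemma inner_vector_ii_left:
  "inner (\<i> *s x) y = - inner x (\<i> *s y)" for x y :: "complex^'n"
  by (simp add: inner_vec_def inner_complex_def sum_negf[symmetric] algebra_simps)

text \<open>The left side is the imaginary part of the Hermitian form of \<open>A\<close> at
  \<open>x\<close>. Moving \<open>A\<close> and then \<open>\<i>\<close> across the inner product
  shows that it equals its own negative.\<close>

lemma hermitian_inner_ii:
  fixes A :: "complex^'n^'n"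
  assumes "hermitian A"
  shows "inner (\<i> *s x) (A *v x) = 0"
proof -
  have "inner (\<i> *s x) (A *v x) = inner (A *v (\<i> *s x)) x"
    using hermitian_inner[OF assms] .
  also have "\<dots> = inner (\<i> *s (A *v x)) x"
    by (simp add: vector_scalar_commute)
  also have "\<dots> = - inner (\<i> *s x) (A *v x)"
    using inner_vector_ii_left[of x "A *v x"] by (simp add: inner_commute)
  finally show ?thesis by simp
qed

section \<open>Generalized eigenvalues are real and finite in number\<close>

lemma complex_scale_eq:
  "z *s v = Re z *\<^sub>R v + Im z *\<^sub>R (\<i> *s v)" for v :: "complex^'n"
  by (simp add: vec_eq_iff complex_eq_iff)

lemma of_real_scale: "complex_of_real r *s v = r *\<^sub>R v" for v :: "complex^'n"
  by (simp add: vec_eq_iff complex_eq_iff)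

lemma matrix_vector_scaleR: "A *v (r *\<^sub>R v) = r *\<^sub>R (A *v v)" for A :: "complex^'n^'m"
  by (rule linear_cmul[OF matrix_vector_mul_linear])

text \<open>Pairing the eigenvalue equation with \<open>\<i> *s c\<close> isolates
  \<open>Im \<nu>\<close> times the form of \<open>G\<close> at \<open>c\<close>, which is positive,
  while the form of \<open>A\<close> contributes zero.\<close>

lemma gen_eigenvalue_real:
  fixes A G :: "complex^'n^'n"
  assumes "hermitian A" "hermitian G" and pos: "\<And>x. x \<noteq> 0 \<Longrightarrow> 0 < inner x (G *v x)"
    and "\<nu> \<in> gen_eigenvalues A G"
  obtains c where "c \<noteq> 0" "A *v c = Re \<nu> *\<^sub>R (G *v c)" "\<nu> \<in> \<real>"
proof -
  obtain c where c: "c \<noteq> 0" "A *v c = \<nu> *s (G *v c)"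
    using assms(4) by (auto simp: gen_eigenvalues_def)
  have ii: "inner (\<i> *s x) (\<i> *s y) = inner x y" for x y :: "complex^'n"
    by (simp add: inner_vec_def inner_complex_def add.commute)
  have "0 = inner (\<i> *s c) (A *v c)"
    using hermitian_inner_ii[OF assms(1)] by simp
  also have "\<dots> = Im \<nu> * inner c (G *v c)"
    by (simp add: c(2) complex_scale_eq[of \<nu>] inner_add_right ii hermitian_inner_ii[OF assms(2)])
  finally have Im: "Im \<nu> = 0"
    using pos[OF c(1)] by simp
  with c show ?thesis
    by (intro that[of c]) (auto simp: complex_scale_eq[of \<nu>] complex_is_Real_iff)
qed

text \<open>One eigenvector is chosen for each eigenvalue. Orthogonality with respect to
  \<open>G\<close> makes this choice injective and its image linearly independent over the reals,
  hence finite.\<close>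

lemma finite_gen_eigenvalues:
  fixes A G :: "complex^'n^'n"
  assumes "hermitian A" "hermitian G" and pos: "\<And>x. x \<noteq> 0 \<Longrightarrow> 0 < inner x (G *v x)"
  shows "finite (gen_eigenvalues A G)"
proof -
  let ?S = "gen_eigenvalues A G"
  have "\<forall>\<nu>\<in>?S. \<exists>c. c \<noteq> 0 \<and> A *v c = Re \<nu> *\<^sub>R (G *v c) \<and> \<nu> \<in> \<real>"
    using gen_eigenvalue_real[OF assms] by metis
  then obtain v where v: "\<And>\<nu>. \<nu> \<in> ?S \<Longrightarrow> v \<nu> \<noteq> 0"
      "\<And>\<nu>. \<nu> \<in> ?S \<Longrightarrow> A *v v \<nu> = Re \<nu> *\<^sub>R (G *v v \<nu>)"
      "\<And>\<nu>. \<nu> \<in> ?S \<Longrightarrow> \<nu> \<in> \<real>"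
    by metis
  have orth: "inner (v \<mu>) (G *v v \<nu>) = 0" if "\<mu> \<in> ?S" "\<nu> \<in> ?S" "\<mu> \<noteq> \<nu>" for \<mu> \<nu>
  proof -
    have "Re \<nu> * inner (v \<mu>) (G *v v \<nu>) = inner (v \<mu>) (A *v v \<nu>)"
      using v(2)[OF that(2)] by simp
    also have "\<dots> = inner (A *v v \<mu>) (v \<nu>)"
      by (rule hermitian_inner[OF assms(1)])
    also have "\<dots> = Re \<mu> * inner (v \<mu>) (G *v v \<nu>)"
      using v(2)[OF that(1)] hermitian_inner[OF assms(2)] by simp
    finally show ?thesis
      using that v(3) by (auto simp: complex_is_Real_iff complex_eq_iff)
  qed
  have inj: "inj_on v ?S"
    using orth pos v(1) by (metis inj_onI less_irrefl)
  \<comment> \<open>Pairing a vanishing combination with \<open>G *v w\<close> kills every term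
    except that of \<open>w\<close>.\<close>
  have "u w = 0" if T: "finite T" "T \<subseteq> v ` ?S" "(\<Sum>w\<in>T. u w *\<^sub>R w) = 0" "w \<in> T" for T u w
  proof -
    have w: "w \<noteq> 0" using T(2,4) v(1) by auto
    have "0 = inner (\<Sum>x\<in>T. u x *\<^sub>R x) (G *v w)" using T(3) by simp
    also have "\<dots> = (\<Sum>x\<in>T. u x * inner x (G *v w))" by (simp add: inner_sum_left)
    also have "\<dots> = (\<Sum>x\<in>T. if x = w then u w * inner w (G *v w) else 0)"
    proof (rule sum.cong[OF refl])
      fix x assume "x \<in> T"
      then obtain \<mu> \<nu> where "\<mu> \<in> ?S" "x = v \<mu>" "\<nu> \<in> ?S" "w = v \<nu>"
        using T(2,4) by blast
      then show "u x * inner x (G *v w) = (if x = w then u w * inner w (G *v w) else 0)"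
        using orth by (cases "x = w") auto
    qed
    also have "\<dots> = u w * inner w (G *v w)" using T(1,4) by simp
    finally show ?thesis using pos[OF w] by simp
  qed
  then have "independent (v ` ?S)"
    unfolding independent_explicit_module by blast
  then have "finite (v ` ?S)"
    by (rule independent_imp_finite)
  then show ?thesis
    using inj by (rule finite_imageD)
qed

section \<open>Rayleigh quotients and their minima\<close>

lemma semidefinite_zero:
  fixes N :: "complex^'n^'n"
  assumes "hermitian N" and psd: "\<And>x. 0 \<le> inner x (N *v x)" and x: "inner x (N *v x) = 0"
  shows "N *v x = 0"
proof -
  let ?y = "N *v x"
  let ?b = "inner ?y (N *v ?y)"
  \<comment> \<open>This is the form of \<open>N\<close> at \<open>x + t *\<^sub>R ?y\<close>. It
    vanishes at \<open>t = 0\<close> with slope twice the square of \<open>norm ?y\<close>, so a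
    small negative \<open>t\<close> would make it negative unless \<open>?y = 0\<close>.\<close>
  have quad: "0 \<le> 2 * t * (norm ?y)\<^sup>2 + t\<^sup>2 * ?b" for t
  proof -
    have "inner x (N *v ?y) = inner ?y ?y"
      by (rule hermitian_inner[OF assms(1)])
    then have "inner (x + t *\<^sub>R ?y) (N *v (x + t *\<^sub>R ?y)) = 2 * t * (norm ?y)\<^sup>2 + t\<^sup>2 * ?b"
      unfolding power2_norm_eq_inner using x
      by (simp add: matrix_vector_right_distrib matrix_vector_scaleR inner_add_left
          inner_add_right algebra_simps power2_eq_square)
    then show ?thesis using psd[of "x + t *\<^sub>R ?y"] by simp
  qed
  have "(norm ?y)\<^sup>2 \<le> 0"
  proof (rule ccontr)
    assume "\<not> ?thesis"
    then have a: "(norm ?y)\<^sup>2 > 0" by simp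
    have b: "?b \<ge> 0" by (rule psd)
    \<comment> \<open>The denominator \<open>?b + 1\<close> is positive even if
      \<open>?b = 0\<close>, and it keeps \<open>t * ?b\<close> above minus the square of
      \<open>norm ?y\<close>, so the linear term wins.\<close>
    define t where "t = - (norm ?y)\<^sup>2 / (?b + 1)"
    have t: "t < 0" using a b by (simp add: t_def)
    have "t * ?b \<ge> - (norm ?y)\<^sup>2" using a b by (simp add: t_def field_simps)
    then have "2 * (norm ?y)\<^sup>2 + t * ?b > 0" using a by linarith
    then have "t * (2 * (norm ?y)\<^sup>2 + t * ?b) < 0" using t by (simp add: mult_neg_pos)
    then show False using quad[of t] by (simp add: algebra_simps power2_eq_square)
  qed
  then show ?thesis by simp
qed

lemma hermitian_diff_scaleR:
  "hermitian A \<Longrightarrow> hermitian G \<Longrightarrow> hermitian (A - r *\<^sub>R G)"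
  by (auto simp: hermitian_def conj_transpose_def vec_eq_iff)

lemma matrix_vector_diff_scaleR:
  fixes A G :: "complex^'n^'m"
  shows "(A - r *\<^sub>R G) *v y = A *v y - r *\<^sub>R (G *v y)"
  by (simp add: vec_eq_iff matrix_vector_mult_def left_diff_distrib sum_subtractf scaleR_sum_right)

lemma rayleigh_minimizer:
  fixes A G :: "complex^'n^'n"
  assumes "hermitian A" "hermitian G" and pos: "\<And>x. x \<noteq> 0 \<Longrightarrow> 0 < inner x (G *v x)"
  obtains \<mu> x where "x \<noteq> 0" "A *v x = \<mu> *\<^sub>R (G *v x)"
    "\<And>y. \<mu> * inner y (G *v y) \<le> inner y (A *v y)"
proof -
  let ?q = "\<lambda>x. inner x (A *v x) / inner x (G *v x)"
  let ?S = "sphere (0::complex^'n) 1"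
  have ne: "?S \<noteq> {}" by simp
  have "continuous_on ?S ?q"
  proof (intro continuous_intros ballI)
    show "inner x (G *v x) \<noteq> 0" if "x \<in> ?S" for x
      using pos[of x] that by force
  qed
  from continuous_attains_inf[OF compact_sphere ne this]
  obtain x where x: "x \<in> ?S" and min: "\<And>y. y \<in> ?S \<Longrightarrow> ?q x \<le> ?q y"
    by blast
  have x0: "x \<noteq> 0" using x by auto
  define \<mu> where "\<mu> = ?q x"
  have le: "\<mu> * inner y (G *v y) \<le> inner y (A *v y)" for y
  proof (cases "y = 0")
    case False
    \<comment> \<open>The quotient is invariant under real scaling, so its minimum on the sphere is
      a bound for all nonzero vectors.\<close>
    let ?z = "(1 / norm y) *\<^sub>R y"
    have "?z \<in> ?S" using False by simp
    then have "\<mu> \<le> ?q ?z" unfolding \<mu>_def by (rule min)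
    also have "?q ?z = ?q y"
      using False by (simp add: matrix_vector_scaleR)
    finally show ?thesis
      using pos[OF False] by (simp add: pos_le_divide_eq)
  qed simp
  \<comment> \<open>By minimality this matrix is positive semidefinite and its form vanishes at
    \<open>x\<close>; \<open>semidefinite_zero\<close> then gives the eigenvalue equation without
    differentiating the quotient.\<close>
  let ?N = "A - \<mu> *\<^sub>R G"
  have "?N *v x = 0"
  proof (rule semidefinite_zero)
    show "hermitian ?N" using assms by (intro hermitian_diff_scaleR)
    show "0 \<le> inner y (?N *v y)" for y
      using le[of y] by (simp add: matrix_vector_diff_scaleR inner_diff_right)
    show "inner x (?N *v x) = 0"
      using pos[OF x0] by (simp add: matrix_vector_diff_scaleR inner_diff_right \<mu>_def)
  qed
  then have "A *v x = \<mu> *\<^sub>R (G *v x)" by (simp add: matrix_vector_diff_scaleR)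
  with x0 le show ?thesis using that by blast
qed

text \<open>The minimum \<open>r\<close> of the quotient is itself a generalized eigenvalue, and
  evaluating its inequality at an eigenvector for \<open>s\<close> gives
  \<open>r \<le> s\<close>.\<close>

lemma Min_gen_eigenvalues:
  fixes A G :: "complex^'n^'n"
  assumes "hermitian A" "hermitian G" and pos: "\<And>x. x \<noteq> 0 \<Longrightarrow> 0 < inner x (G *v x)"
  defines "\<mu> \<equiv> Min (Re ` gen_eigenvalues A G)"
  obtains x where "x \<noteq> 0" "A *v x = \<mu> *\<^sub>R (G *v x)"
    "\<And>y. \<mu> * inner y (G *v y) \<le> inner y (A *v y)"
proof -
  obtain r x where x: "x \<noteq> 0" "A *v x = r *\<^sub>R (G *v x)"
    and le: "\<And>y. r * inner y (G *v y) \<le> inner y (A *v y)"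
    using rayleigh_minimizer[OF assms(1-3)] by blast
  have "\<mu> = r"
    unfolding \<mu>_def
  proof (rule Min_eqI)
    show "finite (Re ` gen_eigenvalues A G)"
      using finite_gen_eigenvalues[OF assms(1-3)] by simp
    have "of_real r \<in> gen_eigenvalues A G"
      using x by (auto simp: gen_eigenvalues_def of_real_scale)
    then show "r \<in> Re ` gen_eigenvalues A G"
      by (metis Re_complex_of_real imageI)
    fix s assume "s \<in> Re ` gen_eigenvalues A G"
    then obtain \<nu> where \<nu>: "\<nu> \<in> gen_eigenvalues A G" "s = Re \<nu>" by blast
    then obtain c where c: "c \<noteq> 0" "A *v c = s *\<^sub>R (G *v c)"
      using gen_eigenvalue_real[OF assms(1-3)] by metis
    then show "r \<le> s" using le[of c] pos[OF c(1)] by simp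
  qed
  with x le show ?thesis using that by blast
qed

section \<open>Operator norm and perturbation of the smallest eigenvalue\<close>

lemma op_norm_nonneg: "0 \<le> op_norm A"
  unfolding op_norm_def by (rule onorm_pos_le) simp

lemma norm_matrix_vector_le: "norm (A *v x) \<le> op_norm A * norm x"
  unfolding op_norm_def by (rule onorm) simp

lemma op_norm_minus: "op_norm (- A) = op_norm A"
proof -
  have "(*v) (- A) = (\<lambda>x. - (A *v x))"
    by (simp add: fun_eq_iff vec_eq_iff matrix_vector_mult_def sum_negf)
  then show ?thesis by (simp only: op_norm_def onorm_neg)
qed

lemma op_norm_minus_commute: "op_norm (A - A') = op_norm (A' - A)"
  using op_norm_minus[of "A' - A"] unfolding minus_diff_eq .

lemma hermitian_mat_1: "hermitian (mat 1)"
  by (auto simp: hermitian_def conj_transpose_def mat_def vec_eq_iff)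

lemma matrix_inv_vector_mult:
  fixes G :: "complex^'n^'n"
  assumes "\<And>x. G *v x = 0 \<Longrightarrow> x = 0"
  shows "matrix_inv G *v (G *v x) = x"
proof -
  have "invertible G"
    using assms by (simp add: invertible_left_inverse matrix_left_invertible_ker)
  \<comment> \<open>\<open>matrix_inv\<close> is defined by choice, so its inverse property is
    extracted from the existence of an inverse.\<close>
  then have "matrix_inv G ** G = mat 1"
    using someI_ex[of "\<lambda>A'. G ** A' = mat 1 \<and> A' ** G = mat 1"]
    unfolding matrix_inv_def invertible_def by blast
  then show ?thesis by (simp add: matrix_vector_mul_assoc)
qed

text \<open>The norm of \<open>matrix_inv G\<close> is at least the reciprocal of the smallest eigenvalue of \<open>G\<close>.\<close>
lemma norm_sq_le_op_norm_inverse: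
  fixes G :: "complex^'n^'n"
  assumes "hermitian G" and pos: "\<And>x. x \<noteq> 0 \<Longrightarrow> 0 < inner x (G *v x)"
  shows "(norm y)\<^sup>2 \<le> op_norm (matrix_inv G) * inner y (G *v y)"
proof -
  \<comment> \<open>With \<open>mat 1\<close> as the second matrix the generalized problem is the
    ordinary one, so \<open>\<mu>\<close> below is the smallest eigenvalue of
    \<open>G\<close>.\<close>
  have "0 < inner x (mat 1 *v x)" if "x \<noteq> 0" for x :: "complex^'n"
    using that by simp
  then obtain \<mu> x where x: "x \<noteq> 0" "G *v x = \<mu> *\<^sub>R x"
    and le: "\<And>y. \<mu> * inner y y \<le> inner y (G *v y)"
    using rayleigh_minimizer[OF assms(1) hermitian_mat_1] by (metis matrix_vector_mul_lid)
  have \<mu>: "\<mu> > 0"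
    using pos[OF x(1)] inner_ge_zero[of x] by (simp add: x(2) zero_less_mult_iff not_less)
  have "z = 0" if "G *v z = 0" for z
    using pos[of z] that by (cases "z = 0") simp_all
  then have "matrix_inv G *v (G *v x) = x"
    by (rule matrix_inv_vector_mult)
  then have "x = matrix_inv G *v (\<mu> *\<^sub>R x)"
    unfolding x(2) by (rule sym)
  then have "norm x \<le> op_norm (matrix_inv G) * (\<mu> * norm x)"
    using norm_matrix_vector_le[of "matrix_inv G" "\<mu> *\<^sub>R x"] \<mu> by simp
  then have "1 \<le> op_norm (matrix_inv G) * \<mu>"
    using x(1) by (simp add: mult.assoc[symmetric])
  then have "(norm y)\<^sup>2 \<le> op_norm (matrix_inv G) * \<mu> * (norm y)\<^sup>2"
    using mult_right_mono[of 1 _ "(norm y)\<^sup>2"] by simp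
  also have "\<dots> = op_norm (matrix_inv G) * (\<mu> * inner y y)"
    by (simp add: power2_norm_eq_inner)
  also have "\<dots> \<le> op_norm (matrix_inv G) * inner y (G *v y)"
    by (intro mult_left_mono le op_norm_nonneg)
  finally show ?thesis .
qed

lemma Min_gen_eigenvalues_diff_le:
  fixes A A' G :: "complex^'n^'n"
  assumes A: "hermitian A" and A': "hermitian A'" and G: "hermitian G"
    and pos: "\<And>x. x \<noteq> 0 \<Longrightarrow> 0 < inner x (G *v x)"
  shows "Min (Re ` gen_eigenvalues A' G) - Min (Re ` gen_eigenvalues A G)
    \<le> op_norm (matrix_inv G) * op_norm (A' - A)" (is "?m' - ?m \<le> ?k * ?d")
proof -
  obtain x where x: "x \<noteq> 0" "A *v x = ?m *\<^sub>R (G *v x)"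
    using Min_gen_eigenvalues[OF A G pos] by blast
  have "?m' * inner x (G *v x) \<le> inner x (A' *v x)"
    using Min_gen_eigenvalues[OF A' G pos] by blast
  also have "\<dots> = ?m * inner x (G *v x) + inner x ((A' - A) *v x)"
    by (simp add: matrix_vector_mult_diff_rdistrib inner_diff_right x(2))
  also have "inner x ((A' - A) *v x) \<le> norm x * norm ((A' - A) *v x)"
    by (rule norm_cauchy_schwarz)
  also have "\<dots> \<le> norm x * (?d * norm x)"
    by (intro mult_left_mono norm_matrix_vector_le) simp
  also have "\<dots> = ?d * (norm x)\<^sup>2" by (simp add: power2_eq_square)
  \<comment> \<open>The Euclidean norm is traded for the form of \<open>G\<close> at the cost of
    \<open>?k\<close>, so that the positive factor \<open>inner x (G *v x)\<close> can be
    cancelled.\<close>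
  also have "\<dots> \<le> ?d * (?k * inner x (G *v x))"
    by (intro mult_left_mono norm_sq_le_op_norm_inverse G pos op_norm_nonneg)
  finally have "(?m' - ?m) * inner x (G *v x) \<le> (?k * ?d) * inner x (G *v x)"
    by (simp add: algebra_simps)
  then show ?thesis using pos[OF x(1)] by (rule mult_right_le_imp_le)
qed

text \<open>The one-sided bound is used twice, with \<open>A\<close> and \<open>A'\<close> exchanged
  the second time.\<close>

lemma Min_gen_eigenvalues_perturbation:
  fixes A A' G :: "complex^'n^'n"
  assumes "hermitian A" "hermitian A'" "hermitian G"
    and "\<And>x. x \<noteq> 0 \<Longrightarrow> 0 < inner x (G *v x)"
  shows "\<bar>Min (Re ` gen_eigenvalues A' G) - Min (Re ` gen_eigenvalues A G)\<bar>
    \<le> op_norm (matrix_inv G) * op_norm (A' - A)"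
  using Min_gen_eigenvalues_diff_le[OF assms] Min_gen_eigenvalues_diff_le[OF assms(2,1,3,4)]
  by (simp add: op_norm_minus_commute[of A A'] abs_le_iff)

section \<open>Gram matrices for the Frobenius inner product\<close>

lemma trace_conj_transpose_mult:
  fixes A B :: "complex^'n^'m"
  shows "trace (conj_transpose A ** B) = (\<Sum>k\<in>UNIV. \<Sum>l\<in>UNIV. cnj (A $ k $ l) * B $ k $ l)"
  unfolding trace_def matrix_matrix_mult_def conj_transpose_def
  by (simp, rule sum.swap)

lemma hermitian_gram_mat: "hermitian (gram_mat B)"
proof -
  have "cnj (gram_mat B $ j $ i) = gram_mat B $ i $ j" for i j
    by (simp add: gram_mat_def trace_conj_transpose_mult cnj_sum mult.commute)
  then show ?thesis
    by (simp add: hermitian_def conj_transpose_def vec_eq_iff)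
qed

lemma gram_mat_inner:
  fixes B :: "'d::finite \<Rightarrow> complex^'n^'n"
  defines "S \<equiv> \<lambda>c::complex^'d. (\<Sum>i\<in>UNIV. (\<chi> k l. c $ i * B i $ k $ l))"
  shows "inner c (gram_mat B *v c) = (norm (S c))\<^sup>2"
proof -
  let ?t = "\<lambda>i j k l. cnj (c $ i) * (cnj (B i $ k $ l) * B j $ k $ l * c $ j)"
  have S: "S c $ k $ l = (\<Sum>i\<in>UNIV. c $ i * B i $ k $ l)" for k l
    by (simp add: S_def)
  have "(\<Sum>i\<in>UNIV. cnj (c $ i) * (gram_mat B *v c) $ i)
      = (\<Sum>i\<in>UNIV. \<Sum>j\<in>UNIV. \<Sum>k\<in>UNIV. \<Sum>l\<in>UNIV. ?t i j k l)"
    by (simp add: matrix_vector_mult_def gram_mat_def trace_conj_transpose_mult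
        sum_distrib_left sum_distrib_right)
  \<comment> \<open>The swaps bring the entry indices \<open>k\<close>, \<open>l\<close> outside;
    for fixed \<open>k\<close> and \<open>l\<close> the double sum over \<open>i\<close> and
    \<open>j\<close> then factors into an entry of \<open>S c\<close> and its conjugate.\<close>
  also have "\<dots> = (\<Sum>i\<in>UNIV. \<Sum>k\<in>UNIV. \<Sum>j\<in>UNIV. \<Sum>l\<in>UNIV. ?t i j k l)"
    by (intro sum.cong refl sum.swap)
  also have "\<dots> = (\<Sum>i\<in>UNIV. \<Sum>k\<in>UNIV. \<Sum>l\<in>UNIV. \<Sum>j\<in>UNIV. ?t i j k l)"
    by (intro sum.cong refl sum.swap)
  also have "\<dots> = (\<Sum>k\<in>UNIV. \<Sum>i\<in>UNIV. \<Sum>l\<in>UNIV. \<Sum>j\<in>UNIV. ?t i j k l)"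
    by (rule sum.swap)
  also have "\<dots> = (\<Sum>k\<in>UNIV. \<Sum>l\<in>UNIV. \<Sum>i\<in>UNIV. \<Sum>j\<in>UNIV. ?t i j k l)"
    by (intro sum.cong refl sum.swap)
  also have "\<dots> = (\<Sum>k\<in>UNIV. \<Sum>l\<in>UNIV. cnj (S c $ k $ l) * S c $ k $ l)"
    unfolding S cnj_sum sum_product by (simp add: mult_ac)
  finally have "Re (\<Sum>i\<in>UNIV. cnj (c $ i) * (gram_mat B *v c) $ i)
      = Re (\<Sum>k\<in>UNIV. \<Sum>l\<in>UNIV. cnj (S c $ k $ l) * S c $ k $ l)"
    by (rule arg_cong)
  then show ?thesis
    unfolding power2_norm_eq_inner inner_vec_def inner_complex_Re Re_sum .
qed

lemma gram_mat_pos: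
  fixes B :: "'d::finite \<Rightarrow> complex^'n^'n"
  assumes "lin_indep_family B" "c \<noteq> 0"
  shows "0 < inner c (gram_mat B *v c)"
proof -
  have "(\<Sum>i\<in>UNIV. (\<chi> k l. c $ i * B i $ k $ l)) \<noteq> (0::complex^'n^'n)"
  proof
    assume "(\<Sum>i\<in>UNIV. (\<chi> k l. c $ i * B i $ k $ l)) = (0::complex^'n^'n)"
    then have "\<forall>i. c $ i = 0"
      using assms(1)[unfolded lin_indep_family_def, rule_format, of "\<lambda>i. c $ i"] by blast
    then show False
      using assms(2) by (simp add: vec_eq_iff)
  qed
  then show ?thesis by (simp add: gram_mat_inner)
qed

section \<open>Self-adjointness of commutators\<close>

lemma conj_transpose_mult:
  "conj_transpose (A ** B) = conj_transpose B ** conj_transpose A"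
  by (simp add: conj_transpose_def matrix_matrix_mult_def vec_eq_iff cnj_sum mult.commute)

lemma conj_transpose_diff:
  "conj_transpose (A - B) = conj_transpose A - conj_transpose B"
  by (simp add: conj_transpose_def vec_eq_iff)

lemma matrix_add_rdistrib: "(B + C) ** A = B ** A + C ** A" for A :: "complex^'n^'m"
  by (simp add: matrix_matrix_mult_def vec_eq_iff distrib_right sum.distrib)

lemma matrix_diff_ldistrib: "A ** (B - C) = A ** B - A ** C" for A :: "complex^'n^'m"
  by (simp add: matrix_matrix_mult_def vec_eq_iff right_diff_distrib sum_subtractf)

lemma matrix_diff_rdistrib: "(B - C) ** A = B ** A - C ** A" for A :: "complex^'n^'m"
  by (simp add: matrix_matrix_mult_def vec_eq_iff left_diff_distrib sum_subtractf)

text \<open>Left multiplication by a Hermitian \<open>X\<close> is self-adjoint for the Frobenius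
  inner product, and cyclicity of the trace gives the same for right multiplication.\<close>

lemma trace_commutator:
  assumes "hermitian X"
  shows "trace (conj_transpose A ** commutator X B) = trace (conj_transpose (commutator X A) ** B)"
proof -
  have "trace (conj_transpose A ** (B ** X)) = trace (X ** (conj_transpose A ** B))"
    by (metis matrix_mul_assoc trace_mul_sym)
  with assms show ?thesis
    by (simp add: commutator_def conj_transpose_diff conj_transpose_mult hermitian_def
        matrix_diff_ldistrib matrix_diff_rdistrib trace_sub matrix_mul_assoc)
qed

lemma M_mat_eq_gram_mat:
  assumes "hermitian X"
  shows "M_mat B X = gram_mat (\<lambda>i. commutator X (B i))"
  by (simp add: M_mat_def gram_mat_def trace_commutator[OF assms])

section \<open>Frobenius norm estimates for products and commutators\<close>

lemma norm_trace_conj_transpose_mult_le: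
  fixes A B :: "complex^'n^'m"
  shows "norm (trace (conj_transpose A ** B)) \<le> norm A * norm B"
proof -
  have "norm (trace (conj_transpose A ** B))
      \<le> (\<Sum>k\<in>UNIV. \<Sum>l\<in>UNIV. norm (A $ k $ l) * norm (B $ k $ l))"
    unfolding trace_conj_transpose_mult
    by (intro sum_norm_le) (simp add: norm_mult)
  \<comment> \<open>Cauchy-Schwarz is applied within each row here, and to the vectors of row norms
    in the next step.\<close>
  also have "\<dots> \<le> (\<Sum>k\<in>UNIV. norm (A $ k) * norm (B $ k))"
    using L2_set_mult_ineq[of "\<lambda>l. norm (A $ k $ l)" "\<lambda>l. norm (B $ k $ l)" UNIV for k]
    by (intro sum_mono) (simp add: norm_vec_def)
  also have "\<dots> \<le> norm A * norm B"
    using L2_set_mult_ineq[of "\<lambda>k. norm (A $ k)" "\<lambda>k. norm (B $ k)" UNIV]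
    by (simp add: norm_vec_def)
  finally show ?thesis .
qed

lemma norm_vec_power2: "(norm x)\<^sup>2 = (\<Sum>i\<in>UNIV. (norm (x $ i))\<^sup>2)"
  by (simp add: norm_vec_def L2_set_def sum_nonneg)

text \<open>The library norm is built from rows, whereas left multiplication acts column by column;
  this bridges the two for \<open>norm_matrix_mult_le\<close>.\<close>

lemma norm_columns_power2:
  fixes A :: "complex^'n^'m"
  shows "(norm A)\<^sup>2 = (\<Sum>j\<in>UNIV. (norm (column j A))\<^sup>2)"
  unfolding norm_vec_power2 by (simp add: column_def) (rule sum.swap)

lemma norm_conj_transpose: "norm (conj_transpose A) = norm A"
proof -
  have "(norm (conj_transpose A))\<^sup>2 = (norm A)\<^sup>2"
    unfolding norm_columns_power2[of A]
    by (simp add: norm_vec_power2 column_def conj_transpose_def)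
  then show ?thesis by simp
qed

lemma norm_matrix_mult_le:
  fixes X :: "complex^'n^'m" and Y :: "complex^'k^'n"
  shows "norm (X ** Y) \<le> op_norm X * norm Y"
proof -
  have col: "column j (X ** Y) = X *v column j Y" for j
    by (simp add: column_def matrix_matrix_mult_def matrix_vector_mult_def vec_eq_iff)
  have "(norm (X ** Y))\<^sup>2 = (\<Sum>j\<in>UNIV. (norm (X *v column j Y))\<^sup>2)"
    by (simp add: norm_columns_power2[of "X ** Y"] col)
  also have "\<dots> \<le> (\<Sum>j\<in>UNIV. (op_norm X * norm (column j Y))\<^sup>2)"
    by (intro sum_mono power_mono norm_matrix_vector_le norm_ge_zero)
  also have "\<dots> = (op_norm X * norm Y)\<^sup>2"
    by (simp add: power_mult_distrib sum_distrib_left norm_columns_power2[of Y])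
  finally show ?thesis
    by (rule power2_le_imp_le) (simp add: op_norm_nonneg)
qed

text \<open>Conjugate transposition preserves the Frobenius norm and fixes \<open>X\<close>, so the
  product with \<open>X\<close> on the right is bounded like the one with \<open>X\<close> on the
  left.\<close>

lemma norm_commutator_le:
  assumes "hermitian X"
  shows "norm (commutator X Y) \<le> 2 * op_norm X * norm Y"
proof -
  have "norm (Y ** X) = norm (conj_transpose (Y ** X))" by (simp add: norm_conj_transpose)
  also have "\<dots> = norm (X ** conj_transpose Y)"
    using assms by (simp add: conj_transpose_mult hermitian_def)
  also have "\<dots> \<le> op_norm X * norm Y"
    using norm_matrix_mult_le[of X "conj_transpose Y"] by (simp add: norm_conj_transpose)
  finally show ?thesis
    using norm_matrix_mult_le[of X Y] norm_triangle_ineq4[of "X ** Y" "Y ** X"]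
    by (simp add: commutator_def)
qed

lemma norm_commutator_commutator_le:
  assumes "hermitian X" "hermitian Y"
  shows "norm (commutator X (commutator Y Z)) \<le> 4 * op_norm X * op_norm Y * norm Z"
proof -
  have "norm (commutator X (commutator Y Z)) \<le> 2 * op_norm X * norm (commutator Y Z)"
    by (rule norm_commutator_le[OF assms(1)])
  also have "\<dots> \<le> 2 * op_norm X * (2 * op_norm Y * norm Z)"
    by (intro mult_left_mono norm_commutator_le assms) (simp add: op_norm_nonneg)
  finally show ?thesis by simp
qed

section \<open>Perturbation of the double commutator and of \<open>M_mat\<close>\<close>

lemma commutator_add_left: "commutator (X + Y) Z = commutator X Z + commutator Y Z"
  by (simp add: commutator_def matrix_add_ldistrib matrix_add_rdistrib)

lemma commutator_add_right: "commutator X (Y + Z) = commutator X Y + commutator X Z"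
  by (simp add: commutator_def matrix_add_ldistrib matrix_add_rdistrib)

lemma norm_double_commutator_diff_le:
  assumes "hermitian R" "hermitian E"
  shows "norm (commutator (R + E) (commutator (R + E) Z) - commutator R (commutator R Z))
    \<le> 4 * op_norm E * (2 * op_norm R + op_norm E) * norm Z"
proof -
  have "commutator (R + E) (commutator (R + E) Z) - commutator R (commutator R Z)
      = commutator R (commutator E Z) + commutator E (commutator R Z) + commutator E (commutator E Z)"
    by (simp add: commutator_add_left commutator_add_right)
  also have "norm \<dots> \<le> norm (commutator R (commutator E Z)) + norm (commutator E (commutator R Z))
      + norm (commutator E (commutator E Z))"
    by (intro norm_triangle_le add_mono norm_triangle_ineq order_refl)
  also have "\<dots> \<le> 4 * op_norm R * op_norm E * norm Z + 4 * op_norm E * op_norm R * norm Z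
      + 4 * op_norm E * op_norm E * norm Z"
    by (intro add_mono norm_commutator_commutator_le assms)
  finally show ?thesis by (simp add: algebra_simps)
qed

text \<open>The entries are dominated by those of the rank-one matrix
  \<open>K * (b i * b j)\<close>, whose norm is the claimed bound. Cauchy-Schwarz against
  \<open>b\<close> controls each component of \<open>A *v x\<close>.\<close>

lemma op_norm_le_of_entries:
  fixes A :: "complex^'d^'d"
  assumes "0 \<le> K" and entries: "\<And>i j. norm (A $ i $ j) \<le> K * (b i * b j)"
    and b: "\<And>i. 0 \<le> b i"
  shows "op_norm A \<le> K * (\<Sum>i\<in>UNIV. (b i)\<^sup>2)"
  unfolding op_norm_def
proof (rule onorm_le)
  fix x :: "complex^'d"
  let ?L = "L2_set b UNIV"
  have L: "?L * ?L = (\<Sum>i\<in>UNIV. (b i)\<^sup>2)"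
    by (simp add: L2_set_def sum_nonneg)
  have comp: "norm ((A *v x) $ i) \<le> K * ?L * norm x * b i" for i
  proof -
    have "norm ((A *v x) $ i) \<le> (\<Sum>j\<in>UNIV. K * (b i * b j) * norm (x $ j))"
      unfolding matrix_vector_mult_def
      by (simp, intro sum_norm_le) (simp add: norm_mult mult_right_mono entries)
    also have "\<dots> = K * b i * (\<Sum>j\<in>UNIV. b j * norm (x $ j))"
      by (simp add: sum_distrib_left mult_ac)
    also have "\<dots> \<le> K * b i * (?L * norm x)"
      using L2_set_mult_ineq[of b "\<lambda>j. norm (x $ j)" UNIV] b assms(1)
      by (intro mult_left_mono) (auto simp: norm_vec_def)
    finally show ?thesis by (simp add: mult_ac)
  qed
  have "norm (A *v x) \<le> L2_set (\<lambda>i. K * ?L * norm x * b i) UNIV"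
    unfolding norm_vec_def[of "A *v x"] by (intro L2_set_mono comp) simp
  also have "\<dots> = K * ?L * norm x * ?L"
    using assms(1) by (simp add: L2_set_right_distrib L2_set_nonneg)
  also have "\<dots> = K * (\<Sum>i\<in>UNIV. (b i)\<^sup>2) * norm x"
    by (simp add: L[symmetric])
  finally show "norm (A *v x) \<le> K * (\<Sum>i\<in>UNIV. (b i)\<^sup>2) * norm x" .
qed

text \<open>The entrywise criterion applies with \<open>b i = norm (B i)\<close>, whose sum of
  squares is \<open>C_B B\<close>.\<close>

lemma op_norm_M_mat_diff_le:
  assumes "hermitian R" "hermitian E"
  shows "op_norm (M_mat B (R + E) - M_mat B R)
    \<le> 4 * op_norm E * (2 * op_norm R + op_norm E) * C_B B"
  unfolding C_B_def
proof (rule op_norm_le_of_entries)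
  let ?K = "4 * op_norm E * (2 * op_norm R + op_norm E)"
  let ?D = "\<lambda>Z. commutator (R + E) (commutator (R + E) Z) - commutator R (commutator R Z)"
  show "0 \<le> ?K" by (simp add: op_norm_nonneg)
  fix i j
  have "norm ((M_mat B (R + E) - M_mat B R) $ i $ j) = norm (trace (conj_transpose (B i) ** ?D (B j)))"
    by (simp add: M_mat_def matrix_diff_ldistrib trace_sub)
  also have "\<dots> \<le> norm (B i) * norm (?D (B j))"
    by (rule norm_trace_conj_transpose_mult_le)
  also have "\<dots> \<le> norm (B i) * (?K * norm (B j))"
    by (intro mult_left_mono norm_double_commutator_diff_le assms) simp
  finally show "norm ((M_mat B (R + E) - M_mat B R) $ i $ j) \<le> ?K * (norm (B i) * norm (B j))"
    by (simp add: mult_ac)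
qed simp

theorem theorem9p3:
  fixes R E :: "complex^'m^'m" and B :: "'d::finite \<Rightarrow> complex^'m^'m"
  assumes "hermitian R" and "hermitian E"
    and "lin_indep_family B"
  shows "\<bar>lambda_min B (R + E) - lambda_min B R\<bar>
           \<le> kappa_G B * op_norm (M_mat B (R + E) - M_mat B R)
       \<and> kappa_G B * op_norm (M_mat B (R + E) - M_mat B R)
           \<le> 4 * kappa_G B * C_B B * op_norm E * (2 * op_norm R + op_norm E)"
proof
  have "hermitian (R + E)"
    using assms(1,2) by (simp add: hermitian_def conj_transpose_def vec_eq_iff)
  then show "\<bar>lambda_min B (R + E) - lambda_min B R\<bar>
      \<le> kappa_G B * op_norm (M_mat B (R + E) - M_mat B R)"
    \<comment> \<open>Linear independence enters through positivity of the Gram form; rewriting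
      \<open>M_mat\<close> as a Gram matrix shows that both matrices compared are Hermitian.\<close>
    unfolding lambda_min_def kappa_G_def
    using assms(1) gram_mat_pos[OF assms(3)]
    by (intro Min_gen_eigenvalues_perturbation) (simp_all add: M_mat_eq_gram_mat hermitian_gram_mat)
  have "kappa_G B * op_norm (M_mat B (R + E) - M_mat B R)
      \<le> kappa_G B * (4 * op_norm E * (2 * op_norm R + op_norm E) * C_B B)"
    unfolding kappa_G_def
    by (intro mult_left_mono op_norm_M_mat_diff_le assms op_norm_nonneg)
  then show "kappa_G B * op_norm (M_mat B (R + E) - M_mat B R)
      \<le> 4 * kappa_G B * C_B B * op_norm E * (2 * op_norm R + op_norm E)"
    by (simp add: mult_ac)
qed

end
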